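(* Let $m\ge 1$ be an integer and let $P$ be a polynomial in $\Pi_{m,1}$. Then $D_m\subset S_P$ if and only if $$P(z)=\left(1+\frac{z}{m}\right)^m .$$
   Context: For integers $0\le n\le m$, $\Pi_{m,n}$ is the class of polynomials $P(z)=\sum_{k=0}^m \alpha_k \frac{z^k}{k!}$ with $\alpha_0=\dots=\alpha_n=1$ (the coefficients $\alpha_k$, $k>n$, being arbitrary complex numbers). The stability region of $P$ is $S_P=\{z\in\mathbb{C} : |P(z)|\le 1\}$, and $D_r=\{z\in\mathbb{C} : |z+r|\le r\}$. *)

theory Defs
  imports Complex_Main "HOL-Computational_Algebra.Polynomial"
begin

text \<open>
  The normalised coefficients \<open>\<alpha> k\<close> with \<open>k \<le> n\<close> are \<open>1\<close>, the others are arbitrary. In particular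
  \<open>\<alpha> m\<close> may vanish, so \<open>m\<close> only bounds the degree. The class is meant for \<open>n \<le> m\<close>.
\<close>

definition Pi_class :: "nat \<Rightarrow> nat \<Rightarrow> complex poly set" where
  "Pi_class m n =
     {P. \<exists>\<alpha> :: nat \<Rightarrow> complex. (\<forall>k\<le>n. \<alpha> k = 1) \<and> P = (\<Sum>k\<le>m. monom (\<alpha> k / fact k) k)}"

definition stability_region :: "complex poly \<Rightarrow> complex set" where
  "stability_region P = {z. cmod (poly P z) \<le> 1}"

definition stability_disk :: "real \<Rightarrow> complex set" where
  "stability_disk r = {z. cmod (z + complex_of_real r) \<le> r}"

end

theory Submission
  imports Defs
begin

text \<open>
  Put \<open>Q(w) = P(m(w - 1))\<close>. The disk of radius \<open>m\<close> becomes the closed unit disk, the two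
  normalised coefficients become \<open>Q(1) = 1\<close> and \<open>Q'(1) = m\<close>, and the claim becomes the case of
  equality in Bernstein's inequality: if \<open>\<bar>Q\<bar> \<le> 1\<close> on the unit circle, \<open>deg Q \<le> m\<close> and
  \<open>Q(1) = 1\<close>, \<open>Q'(1) = m\<close>, then \<open>Q(w) = w\<^sup>m\<close>.

  The reason is an averaging argument over the \<open>m\<close> roots \<open>w\<close> of \<open>w\<^sup>m = -1\<close>. The polynomial
  \<open>Q(w) - w\<^sup>m\<close> has a double zero at \<open>1\<close>, hence equals \<open>(w - 1)\<^sup>2 S(w)\<close> with
  \<open>deg S \<le> m - 2\<close>. Averaging a polynomial of degree less than \<open>m\<close> over these roots gives its
  constant term, so the values \<open>w S(w)\<close> sum to zero (\<open>sum_poly_nth_roots\<close>). On the unit circle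
  \<open>(w - 1)\<^sup>2 = -w\<bar>w - 1\<bar>\<^sup>2\<close>; therefore \<open>w S(w) = -(Q(w) + 1) / \<bar>w - 1\<bar>\<^sup>2\<close>, whose real part
  is at most \<open>0\<close> because \<open>\<bar>Q(w)\<bar> \<le> 1\<close>. A sum of terms of one sign vanishes only if each
  term does, so \<open>Q(w) = -1\<close> at all \<open>m\<close> roots. Thus \<open>S\<close> has more zeros than its degree
  permits and is zero (\<open>bernstein_equality_case\<close>).
\<close>

text \<open>
  The set of roots is invariant under multiplication by an \<open>m\<close>-th root of unity \<open>u\<close>, which
  multiplies the sum by \<open>u\<^sup>j\<close>. Some \<open>u\<close> has \<open>u\<^sup>j \<noteq> 1\<close>, because there are fewer \<open>j\<close>-th than
  \<open>m\<close>-th roots of unity.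
\<close>

lemma sum_power_nth_roots_eq_0:
  fixes c :: complex
  assumes "0 < j" and "j < m"
  shows "(\<Sum>w | w ^ m = c. w ^ j) = 0"
proof -
  have "card {z::complex. z ^ m = 1} = m" "card {z::complex. z ^ j = 1} = j"
    using assms by (auto intro!: card_nth_roots)
  moreover have "finite {z::complex. z ^ j = 1}"
    using assms by (intro finite_nth_roots) auto
  ultimately have "\<not> {z::complex. z ^ m = 1} \<subseteq> {z. z ^ j = 1}"
    using card_mono assms by (metis linorder_not_less)
  then obtain u :: complex where u: "u ^ m = 1" "u ^ j \<noteq> 1" by blast
  have "u \<noteq> 0" using u(1) assms by (auto simp: power_0_left)
  have "(\<Sum>w | w ^ m = c. w ^ j) = (\<Sum>w | w ^ m = c. (u * w) ^ j)"
    using u(1) \<open>u \<noteq> 0\<close>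
    by (intro sum.reindex_bij_witness[of _ "\<lambda>w. u * w" "\<lambda>w. w / u"])
       (auto simp: power_mult_distrib power_divide)
  also have "\<dots> = u ^ j * (\<Sum>w | w ^ m = c. w ^ j)"
    by (simp add: power_mult_distrib sum_distrib_left)
  finally show ?thesis using u(2) by auto
qed

text \<open>
  A discrete mean value property: the powers \<open>w\<^sup>j\<close> with \<open>0 < j < m\<close> cancel, and only the
  constant term survives.
\<close>

lemma sum_poly_nth_roots:
  fixes c :: complex and p :: "complex poly"
  assumes "c \<noteq> 0" and "degree p < m"
  shows "(\<Sum>w | w ^ m = c. poly p w) = of_nat m * coeff p 0"
proof -
  have "(\<Sum>w | w ^ m = c. poly p w) = (\<Sum>j\<le>degree p. coeff p j * (\<Sum>w | w ^ m = c. w ^ j))"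
    by (subst sum_distrib_left, subst sum.swap) (simp add: poly_altdef)
  also have "\<dots> = (\<Sum>j\<le>degree p. if j = 0 then of_nat m * coeff p 0 else 0)"
    using assms by (intro sum.cong) (auto simp: sum_power_nth_roots_eq_0 card_nth_roots)
  also have "\<dots> = of_nat m * coeff p 0" by simp
  finally show ?thesis .
qed

lemma double_root_factor:
  fixes p :: "'a::idom poly"
  assumes "poly p a = 0" and "poly (pderiv p) a = 0"
  obtains q where "p = [:-a, 1:] * ([:-a, 1:] * q)"
proof -
  obtain g where g: "p = [:-a, 1:] * g"
    using assms(1) by (auto simp: poly_eq_0_iff_dvd)
  have "poly g a = 0"
    using assms(2) unfolding g pderiv_mult by (simp add: pderiv_pCons)
  then obtain q where "g = [:-a, 1:] * q" by (auto simp: poly_eq_0_iff_dvd)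
  with g that show thesis by blast
qed

lemma cmod_root_of_minus_one:
  fixes w :: complex
  assumes "w ^ m = -1" and "m \<ge> 1"
  shows "cmod w = 1"
proof -
  have "cmod w ^ m = 1" using assms(1) by (metis norm_power norm_minus_cancel norm_one)
  then show ?thesis using assms(2) power_eq_1_iff[of "cmod w" m] by auto
qed

lemma unit_circle_minus_one_squared:
  assumes "cmod w = 1"
  shows "(w - 1)\<^sup>2 = - w * of_real ((cmod (w - 1))\<^sup>2)"
proof -
  have w: "w * cnj w = 1"
    using assms by (simp add: complex_norm_square[symmetric])
  have "- w * of_real ((cmod (w - 1))\<^sup>2) = - w * ((w - 1) * (cnj w - 1))"
    by (simp add: complex_norm_square del: of_real_power)
  also have "\<dots> = (w - 1) * (w - w * cnj w)" by (simp add: algebra_simps)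
  finally show ?thesis by (simp add: w power2_eq_square)
qed

text \<open>
  A bound at the roots of \<open>w\<^sup>m = -1\<close> suffices: \<open>-1\<close> has the smallest real part in the closed
  unit disk, so \<open>Q(w) - w\<^sup>m\<close> has nonnegative real part there, while the double zero at \<open>1\<close>
  makes the average of these differences with the positive weights \<open>1 / \<bar>w - 1\<bar>\<^sup>2\<close> vanish.
\<close>

lemma bernstein_equality_case:
  fixes Q :: "complex poly"
  assumes m: "m \<ge> 1" and deg: "degree Q \<le> m"
    and one: "poly Q 1 = 1" and deriv: "poly (pderiv Q) 1 = of_nat m"
    and bound: "\<And>w. w ^ m = -1 \<Longrightarrow> cmod (poly Q w) \<le> 1"
  shows "Q = monom 1 m"
proof -
  define W where "W = {w::complex. w ^ m = -1}"
  have W: "finite W" "card W = m"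
    using m unfolding W_def by (auto intro!: finite_nth_roots card_nth_roots)
  obtain S where S: "Q - monom 1 m = [:-1, 1:] * ([:-1, 1:] * S)"
    using double_root_factor[of "Q - monom 1 m" 1] one deriv
    by (auto simp: pderiv_diff pderiv_monom poly_monom)
  have "S = 0"
  proof (rule ccontr)
    assume "S \<noteq> 0"
    have "degree (Q - monom 1 m) \<le> m"
      using deg by (intro degree_diff_le) (auto simp: degree_monom_le)
    moreover have "degree (Q - monom 1 m) = degree S + 2"
      using \<open>S \<noteq> 0\<close> unfolding S by (simp add: degree_mult_eq del: mult_pCons_left)
    ultimately have degS: "degree S + 2 \<le> m" by simp
    have "degree (pCons 0 S) < m" using degS \<open>S \<noteq> 0\<close> by simp
    from sum_poly_nth_roots[OF _ this, of "-1"]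
    have "(\<Sum>w\<in>W. w * poly S w) = 0" by (simp add: W_def)
    then have sum0: "(\<Sum>w\<in>W. - Re (w * poly S w)) = 0"
      by (simp only: sum_negf Re_sum[symmetric]) simp
    have key: "poly Q w + 1 = - of_real ((cmod (w - 1))\<^sup>2) * (w * poly S w)"
      and pos: "(cmod (w - 1))\<^sup>2 > 0" if "w \<in> W" for w
    proof -
      have wm: "w ^ m = -1" using that by (simp add: W_def)
      then have "cmod w = 1" using m by (rule cmod_root_of_minus_one)
      have "poly Q w + 1 = poly (Q - monom 1 m) w" by (simp add: poly_monom wm)
      also have "\<dots> = (w - 1)\<^sup>2 * poly S w" unfolding S
        by (simp add: power2_eq_square algebra_simps)
      finally show "poly Q w + 1 = - of_real ((cmod (w - 1))\<^sup>2) * (w * poly S w)"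
        using unit_circle_minus_one_squared[OF \<open>cmod w = 1\<close>] by simp
      show "(cmod (w - 1))\<^sup>2 > 0" using wm by auto
    qed
    have re: "Re (poly Q w) + 1 = (cmod (w - 1))\<^sup>2 * (- Re (w * poly S w))" if "w \<in> W" for w
      using arg_cong[OF key[OF that], of Re] by (simp add: algebra_simps del: of_real_power)
    have nonneg: "0 \<le> - Re (w * poly S w)" if "w \<in> W" for w
    proof -
      have "0 \<le> Re (poly Q w) + 1"
        using bound[of w] abs_Re_le_cmod[of "poly Q w"] that by (simp add: W_def)
      then show ?thesis using re[OF that] pos[OF that] by (simp add: zero_le_mult_iff)
    qed
    have "poly S w = 0" if "w \<in> W" for w
    proof -
      have "Re (w * poly S w) = 0"
        using sum_nonneg_0[OF W(1) nonneg sum0 that] by simp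
      then have "Re (poly Q w) = -1" using re[OF that] by simp
      \<comment> \<open>The point of the closed unit disk with real part \<open>-1\<close> is unique.\<close>
      moreover have "(Re (poly Q w))\<^sup>2 + (Im (poly Q w))\<^sup>2 \<le> 1"
        using bound[of w] that by (simp add: W_def cmod_def)
      ultimately have "poly Q w = -1" by (simp add: complex_eq_iff)
      moreover have "w \<noteq> 0" using that m by (auto simp: W_def power_0_left)
      ultimately show ?thesis using key[OF that] pos[OF that] by simp
    qed
    then have "W \<subseteq> {w. poly S w = 0}" by blast
    then have "m \<le> card {w. poly S w = 0}"
      using card_mono[OF poly_roots_finite[OF \<open>S \<noteq> 0\<close>]] W(2) by metis
    also have "\<dots> \<le> degree S" using \<open>S \<noteq> 0\<close> by (rule card_poly_roots_bound)
    finally show False using degS by simp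
  qed
  then show ?thesis using S by simp
qed

lemma Pi_classD:
  assumes "P \<in> Pi_class m 1" and "m \<ge> 1"
  shows "degree P \<le> m" and "poly P 0 = 1" and "poly (pderiv P) 0 = 1"
proof -
  obtain \<alpha> where \<alpha>: "\<alpha> 0 = 1" "\<alpha> 1 = 1" and P: "P = (\<Sum>k\<le>m. monom (\<alpha> k / fact k) k)"
    using assms(1) by (auto simp: Pi_class_def)
  have coeff: "coeff P k = (if k \<le> m then \<alpha> k / fact k else 0)" for k
    by (simp add: P coeff_sum)
  show "degree P \<le> m" by (rule degree_le) (simp add: coeff)
  show "poly P 0 = 1" using \<alpha> by (simp add: poly_0_coeff_0 coeff)
  show "poly (pderiv P) 0 = 1" using \<alpha> assms(2) by (simp add: poly_0_coeff_0 coeff_pderiv coeff)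
qed

theorem proposition3:
  fixes m :: nat and P :: "complex poly"
  assumes "m \<ge> 1" and "P \<in> Pi_class m 1"
  shows "stability_disk (real m) \<subseteq> stability_region P \<longleftrightarrow>
           (\<forall>z. poly P z = (1 + z / of_nat m) ^ m)"
proof
  assume sub: "stability_disk (real m) \<subseteq> stability_region P"
  define L :: "complex poly" where "L = [:- of_nat m, of_nat m:]"
  have L: "poly L w = of_nat m * (w - 1)" for w
    by (simp add: L_def algebra_simps)
  have "P \<circ>\<^sub>p L = monom 1 m"
  proof (rule bernstein_equality_case)
    show "m \<ge> 1" by fact
    show "degree (P \<circ>\<^sub>p L) \<le> m"
      using Pi_classD(1)[OF assms(2,1)] assms(1) by (simp add: L_def degree_pcompose)
    show "poly (P \<circ>\<^sub>p L) 1 = 1"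
      using Pi_classD(2)[OF assms(2,1)] by (simp add: poly_pcompose L)
    show "poly (pderiv (P \<circ>\<^sub>p L)) 1 = of_nat m"
      using Pi_classD(3)[OF assms(2,1)]
      by (simp add: pderiv_pcompose poly_pcompose L) (simp add: L_def pderiv_pCons)
    fix w :: complex
    assume "w ^ m = -1"
    then have "cmod w = 1" using assms(1) by (rule cmod_root_of_minus_one)
    then have "poly L w \<in> stability_disk (real m)"
      by (simp add: stability_disk_def L algebra_simps norm_mult)
    then show "cmod (poly (P \<circ>\<^sub>p L) w) \<le> 1"
      using sub by (auto simp: stability_region_def poly_pcompose)
  qed
  then have PL: "poly P (of_nat m * (w - 1)) = w ^ m" for w
    by (metis L poly_pcompose poly_monom mult_1)
  show "\<forall>z. poly P z = (1 + z / of_nat m) ^ m"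
    using PL[of "1 + z / of_nat m" for z] assms(1) by simp
next
  assume P: "\<forall>z. poly P z = (1 + z / of_nat m) ^ m"
  show "stability_disk (real m) \<subseteq> stability_region P"
  proof
    fix z assume "z \<in> stability_disk (real m)"
    then have z: "cmod (z + of_nat m) \<le> real m" by (simp add: stability_disk_def)
    have "1 + z / of_nat m = (z + of_nat m) / of_nat m"
      using assms(1) by (simp add: field_simps)
    then have "cmod (1 + z / of_nat m) \<le> 1"
      using z assms(1) by (simp add: norm_divide)
    then show "z \<in> stability_region P"
      by (simp add: stability_region_def P norm_power power_le_one)
  qed
qed

end
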